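(* Let $h$ be the unique root in the interval $(0,1)$ of $x^6-x^5-x^4-6 x^3-x^2-x+1 = 0$. Then $$ \operatorname{Li}_{2}\left( h^{6} \right) + 3 \operatorname{Li}_{2}\left( h^{4} \right) - 8 \operatorname{Li}_{2}\left( h^{3} \right) - 5 \operatorname{Li}_{2}\left( h^2 \right) - 8 \operatorname{Li}_{2}(h) - 4 \ln^2(h) = - 5 \zeta(2). $$
   Context: $\operatorname{Li}_2(x)=\sum_{n\ge1}x^n/n^2$ for $|x|\le1$; $\zeta(2)=\pi^2/6$. *)

theory Defs
  imports "HOL-Analysis.Analysis"
begin

text \<open>The dilogarithm on the real interval \<open>[-1, 1]\<close>, where the series converges; the value
  elsewhere is irrelevant. The series starts at exponent 1.\<close>

definition Li2 :: "real \<Rightarrow> real" where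
  "Li2 x = (\<Sum>n. x ^ Suc n / real (Suc n) ^ 2)"

lemma Li2_sums:
  assumes "\<bar>x\<bar> \<le> 1"
  shows "(\<lambda>n. x ^ Suc n / real (Suc n) ^ 2) sums Li2 x"
proof -
  have "summable (\<lambda>n. 1 / real (Suc n) ^ 2)"
    using inverse_squares_sums by (simp add: sums_iff add_ac)
  moreover have "norm (x ^ Suc n / real (Suc n) ^ 2) \<le> 1 / real (Suc n) ^ 2" for n
    using power_le_one[OF abs_ge_zero assms, of "Suc n"]
    by (simp only: real_norm_def abs_divide power_abs abs_of_nat) (rule divide_right_mono, auto)
  ultimately have "summable (\<lambda>n. x ^ Suc n / real (Suc n) ^ 2)"
    by (rule summable_comparison_test'[where N = 0])
  then show ?thesis
    unfolding Li2_def by (rule summable_sums)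
qed

definition zeta2 :: real where
  "zeta2 = (\<Sum>n. 1 / real (Suc n) ^ 2)"

lemma zeta2_eq: "zeta2 = pi\<^sup>2 / 6"
  using inverse_squares_sums by (simp add: zeta2_def sums_iff add_ac)

end

theory Submission
  imports Defs "HOL-Real_Asymp.Real_Asymp"
begin

text \<open>Rogers' normalisation \<open>L x = Li\<^sub>2 x + ln x * ln (1 - x) / 2\<close> turns the functional equations of
  the dilogarithm into exact linear relations: reflection \<open>L x + L (1 - x) = \<zeta>(2)\<close> and Abel's
  five-term relation. The sextic is \<open>(1 + h\<^sup>2)\<^sup>3 = h * (1 + h)\<^sup>4\<close>, and it makes enough elements
  \<open>x\<close> of \<open>\<rat>(h)\<close> available for which \<open>x\<close> and \<open>1 - x\<close> are both units outside 2. Eleven five-term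
  relations among such elements, found by a computer search, combine linearly to the value of
  the ladder in \<open>L\<close>. The remaining logarithmic terms collapse to \<open>4 (ln h)\<^sup>2\<close> because
  \<open>(1 - h + h\<^sup>2) h\<^sup>2 (1 + h)\<^sup>4 = (1 - h)\<^sup>4 (1 + h + h\<^sup>2)\<^sup>3\<close>.\<close>

section \<open>Analytic properties of the dilogarithm series\<close>

lemma Li2_0: "Li2 0 = 0"
  by (simp add: Li2_def)

lemma Li2_1: "Li2 1 = zeta2"
  by (simp add: Li2_def zeta2_def)

text \<open>The M-test with majorant 1/n^2 reaches the endpoints; continuity at 1 later supplies the
  boundary value \<open>zeta2\<close>.\<close>

lemma continuous_on_Li2: "continuous_on {-1..1} Li2"
proof -
  have "uniform_limit {-1..1} (\<lambda>N x. \<Sum>n<N. x ^ Suc n / real (Suc n) ^ 2)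
          (\<lambda>x. \<Sum>n. x ^ Suc n / real (Suc n) ^ 2) sequentially"
  proof (rule Weierstrass_m_test)
    show "summable (\<lambda>n. 1 / real (Suc n) ^ 2)"
      using inverse_squares_sums by (simp add: sums_iff add_ac)
    show "norm (x ^ Suc n / real (Suc n) ^ 2) \<le> 1 / real (Suc n) ^ 2"
      if "x \<in> {-1..1}" for n and x :: real
    proof -
      have "\<bar>x\<bar> ^ Suc n \<le> 1"
        using that by (intro power_le_one) auto
      then show ?thesis
        by (simp only: real_norm_def abs_divide power_abs abs_of_nat) (rule divide_right_mono, auto)
    qed
  qed
  then have "continuous_on {-1..1} (\<lambda>x::real. \<Sum>n. x ^ Suc n / real (Suc n) ^ 2)"
    by (rule uniform_limit_theorem[rotated]) (auto intro!: always_eventually continuous_intros)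
  then show ?thesis
    by (simp add: Li2_def[abs_def])
qed

lemma ln_one_minus_sums:
  fixes x :: real
  assumes "0 < x" "x < 1"
  shows "(\<lambda>n. x ^ n / real (Suc n)) sums (- ln (1 - x) / x)"
proof -
  have "(\<lambda>n. - (x ^ n) / real n) sums ln (1 - x)"
    using ln_series'[of "- x"] assms by simp
  then have "(\<lambda>n. - (x ^ Suc n) / real (Suc n)) sums ln (1 - x)"
    by (subst sums_Suc_iff) simp
  from sums_divide[OF sums_minus[OF this], of x] show ?thesis
    using assms by simp
qed

lemma has_real_derivative_Li2:
  assumes "0 < x" "x < 1"
  shows "(Li2 has_real_derivative (- ln (1 - x) / x)) (at x)"
proof -
  \<comment> \<open>\<open>c 0 = 1 / 0 = 0\<close>, so the series may start at exponent 0, the form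
    that termwise differentiation expects.\<close>
  define c where "c = (\<lambda>n. 1 / real n ^ 2)"
  have "(\<lambda>n. c (Suc n) * y ^ Suc n) sums Li2 y" if "\<bar>y\<bar> \<le> 1" for y
    using Li2_sums[OF that] by (simp add: c_def)
  then have c: "(\<lambda>n. c n * y ^ n) sums Li2 y" if "\<bar>y\<bar> \<le> 1" for y
    using that sums_Suc_iff[of "\<lambda>n. c n * y ^ n" "Li2 y"] by (simp add: c_def)
  have "((\<lambda>y. \<Sum>n. c n * y ^ n) has_real_derivative (\<Sum>n. diffs c n * x ^ n)) (at x)"
    using sums_summable[OF c[of 1]] assms by (intro termdiffs_strong[where K = 1]) auto
  moreover have "(\<Sum>n. diffs c n * x ^ n) = - ln (1 - x) / x"
  proof -
    have "diffs c n * x ^ n = x ^ n / real (Suc n)" for n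
      by (simp add: diffs_def c_def power2_eq_square)
    then show ?thesis
      using ln_one_minus_sums[OF assms] by (simp add: sums_iff)
  qed
  ultimately have "((\<lambda>y. \<Sum>n. c n * y ^ n) has_real_derivative (- ln (1 - x) / x)) (at x)"
    by simp
  then show ?thesis
    by (rule has_field_derivative_transform_within_open[where S = "{0<..<1}"])
      (use assms c in \<open>auto simp: sums_iff\<close>)
qed

section \<open>Rogers' normalisation: derivative and boundary limits\<close>

definition rogers_L :: "real \<Rightarrow> real" where
  "rogers_L x = Li2 x + ln x * ln (1 - x) / 2"

lemma has_real_derivative_rogers_L [derivative_intros]:
  assumes "(f has_real_derivative D) (at x within S)" "0 < f x" "f x < 1"
  shows "((\<lambda>x. rogers_L (f x)) has_real_derivative
           (- (ln (1 - f x) / f x + ln (f x) / (1 - f x)) / 2 * D)) (at x within S)"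
proof -
  have "(rogers_L has_real_derivative
          (- (ln (1 - f x) / f x + ln (f x) / (1 - f x)) / 2)) (at (f x))"
    unfolding rogers_L_def[abs_def] using assms(2,3)
    by (auto intro!: derivative_eq_intros has_real_derivative_Li2 simp: field_simps)
  from DERIV_chain2[OF this assms(1)] show ?thesis .
qed

text \<open>\<open>ln (1 - x)\<close> vanishes to first order at 0 and outweighs the singularity of
  \<open>ln x\<close>.\<close>

lemma ln_mult_ln_one_minus_tendsto_0: "((\<lambda>x::real. ln x * ln (1 - x)) \<longlongrightarrow> 0) (at_right 0)"
proof -
  have "((\<lambda>x::real. x * ln x) \<longlongrightarrow> 0) (at_right 0)" "((\<lambda>x::real. ln (1 - x) / x) \<longlongrightarrow> - 1) (at_right 0)"
    by real_asymp+
  then have "((\<lambda>x::real. (x * ln x) * (ln (1 - x) / x)) \<longlongrightarrow> 0 * - 1) (at_right 0)"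
    by (rule tendsto_mult)
  moreover have "(x * ln x) * (ln (1 - x) / x) = ln x * ln (1 - x)" for x :: real
    by (cases "x = 0") auto
  ultimately show ?thesis
    by simp
qed

lemma rogers_L_tendsto_0: "(rogers_L \<longlongrightarrow> 0) (at_right 0)"
proof -
  have "(Li2 \<longlongrightarrow> Li2 0) (at_right 0)"
    by (rule continuous_on_Icc_at_rightD[of 0 1])
      (auto intro: continuous_on_subset[OF continuous_on_Li2])
  moreover have "((\<lambda>x::real. ln x * ln (1 - x) / 2) \<longlongrightarrow> 0) (at_right 0)"
    using tendsto_divide_zero[OF ln_mult_ln_one_minus_tendsto_0] .
  ultimately have "((\<lambda>x. Li2 x + ln x * ln (1 - x) / 2) \<longlongrightarrow> Li2 0 + 0) (at_right 0)"
    by (rule tendsto_add)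
  then show ?thesis
    by (simp add: rogers_L_def[abs_def] Li2_0)
qed

lemma rogers_L_tendsto_1: "(rogers_L \<longlongrightarrow> zeta2) (at_left 1)"
proof -
  have "(Li2 \<longlongrightarrow> Li2 1) (at_left 1)"
    by (rule continuous_on_Icc_at_leftD[OF continuous_on_Li2]) simp
  moreover have "((\<lambda>x::real. ln x * ln (1 - x) / 2) \<longlongrightarrow> 0) (at_left 1)"
  proof -
    have "filterlim (\<lambda>x::real. 1 - x) (at_right 0) (at_left 1)"
      by real_asymp
    from filterlim_compose[OF ln_mult_ln_one_minus_tendsto_0 this]
    have "((\<lambda>x::real. ln x * ln (1 - x)) \<longlongrightarrow> 0) (at_left 1)"
      by (simp add: mult.commute)
    then show ?thesis
      by (rule tendsto_divide_zero)
  qed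
  ultimately have "((\<lambda>x. Li2 x + ln x * ln (1 - x) / 2) \<longlongrightarrow> Li2 1 + 0) (at_left 1)"
    by (rule tendsto_add)
  then show ?thesis
    by (simp add: rogers_L_def[abs_def] Li2_1)
qed

section \<open>Functional equations from a zero derivative and the limit at the left
  endpoint\<close>

lemma eq_limit_if_zero_derivative:
  fixes f :: "real \<Rightarrow> real"
  assumes d: "\<And>x. a < x \<Longrightarrow> x < b \<Longrightarrow> (f has_real_derivative 0) (at x)"
    and l: "(f \<longlongrightarrow> l) (at_right a)" and x: "a < x" "x < b"
  shows "f x = l"
proof -
  have c: "f y = f x" if "y \<in> {a<..<b}" for y
    by (rule DERIV_isconst3[of a b y x f]) (use that x d in simp_all)
  have "a < b" using x by simp
  then have e: "eventually (\<lambda>y. f y = f x) (at_right a)"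
    by (rule eventually_mono[OF eventually_at_right_real c])
  have "(f \<longlongrightarrow> f x) (at_right a)"
    using e by (rule tendsto_eventually)
  then show ?thesis
    by (rule tendsto_unique[OF trivial_limit_at_right_real _ l])
qed

text \<open>The derivative of \<open>rogers_L\<close> is invariant under exchanging \<open>x\<close>
  and \<open>1 - x\<close>, so that of the sum cancels.\<close>

lemma rogers_L_reflection:
  assumes "0 < x" "x < 1"
  shows "rogers_L x + rogers_L (1 - x) = zeta2"
proof -
  have "filterlim (\<lambda>x::real. 1 - x) (at_left 1) (at_right 0)"
    by real_asymp
  then have lim: "((\<lambda>x. rogers_L x + rogers_L (1 - x)) \<longlongrightarrow> 0 + zeta2) (at_right 0)"
    by (intro tendsto_add rogers_L_tendsto_0 filterlim_compose[OF rogers_L_tendsto_1])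
  have "((\<lambda>x. rogers_L x + rogers_L (1 - x)) has_real_derivative 0) (at x)" if "0 < x" "x < 1" for x
    using that by (auto intro!: derivative_eq_intros simp: add.commute)
  from eq_limit_if_zero_derivative[OF this lim assms] show ?thesis
    by simp
qed

lemma rogers_L_half: "rogers_L (1 / 2) = zeta2 / 2"
  using rogers_L_reflection[of "1 / 2"] by simp

text \<open>With \<open>y\<close> fixed, the difference of the two sides is constant in
  \<open>x\<close> and tends to 0 as \<open>x\<close> does. Cross-multiplied equations for
  \<open>z\<close>, \<open>u\<close>, \<open>v\<close> reduce each application to bounds on
  \<open>x\<close>, \<open>y\<close> and algebra.\<close>

lemma rogers_L_five_term:
  assumes x: "0 < x" "x < 1" and y: "0 < y" "y < 1"
    and z: "x * y = z" and u: "u * (1 - z) = x * (1 - y)" and v: "v * (1 - z) = y * (1 - x)"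
  shows "rogers_L x + rogers_L y = rogers_L z + rogers_L u + rogers_L v"
proof -
  define F where "F = (\<lambda>x. rogers_L x + rogers_L y - rogers_L (x * y)
    - rogers_L (x * (1 - y) / (1 - x * y)) - rogers_L (y * (1 - x) / (1 - x * y)))"
  have lt: "x * y < 1" if "0 < x" "x < 1" for x
    using mult_strict_mono[of x 1 y 1] that y by simp
  have "(F has_real_derivative 0) (at x)" if x: "0 < x" "x < 1" for x
  proof -
    note lt = lt[OF x]
    have xy: "0 < x * y" using x y by simp
    \<comment> \<open>Both complements factor, so every logarithm in the derivative reduces to those
      of \<open>x\<close>, \<open>1 - x\<close>, \<open>y\<close>, \<open>1 - y\<close>,
      \<open>1 - x * y\<close>.\<close>
    have 1: "1 - x * (1 - y) / (1 - x * y) = (1 - x) / (1 - x * y)"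
      and 2: "1 - y * (1 - x) / (1 - x * y) = (1 - y) / (1 - x * y)"
      using lt by (simp_all add: field_simps)
    have u: "0 < x * (1 - y) / (1 - x * y)" "0 < y * (1 - x) / (1 - x * y)"
      using x y lt by simp_all
    have v: "x * (1 - y) / (1 - x * y) < 1" "y * (1 - x) / (1 - x * y) < 1"
      using x y lt 1 2 by (simp_all add: field_simps)
    have l: "ln (x * y) = ln x + ln y"
      "ln (x * (1 - y) / (1 - x * y)) = ln x + ln (1 - y) - ln (1 - x * y)"
      "ln (y * (1 - x) / (1 - x * y)) = ln y + ln (1 - x) - ln (1 - x * y)"
      "ln ((1 - x) / (1 - x * y)) = ln (1 - x) - ln (1 - x * y)"
      "ln ((1 - y) / (1 - x * y)) = ln (1 - y) - ln (1 - x * y)"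
      using x y lt by (simp_all add: ln_mult ln_div)
    have nz: "x \<noteq> 0" "y \<noteq> 0" "1 - x \<noteq> 0" "1 - y \<noteq> 0" "1 - x * y \<noteq> 0"
      using x y lt by auto
    have dz: "((\<lambda>x. x * y) has_real_derivative y) (at x)"
      by (auto intro!: derivative_eq_intros)
    have du: "((\<lambda>x. x * (1 - y) / (1 - x * y)) has_real_derivative (1 - y) / (1 - x * y)\<^sup>2) (at x)"
      by (rule derivative_eq_intros refl nz)+
        (use nz in \<open>simp add: divide_simps power2_eq_square, simp add: algebra_simps\<close>)
    have dv: "((\<lambda>x. y * (1 - x) / (1 - x * y)) has_real_derivative - y * (1 - y) / (1 - x * y)\<^sup>2) (at x)"
      by (rule derivative_eq_intros refl nz)+
        (use nz in \<open>simp add: divide_simps power2_eq_square, simp add: algebra_simps\<close>)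
    note D = has_real_derivative_rogers_L
    note DF = DERIV_diff[OF DERIV_diff[OF DERIV_diff[OF DERIV_add[OF D[OF DERIV_ident x] DERIV_const]
      D[OF dz xy lt]] D[OF du u(1) v(1)]] D[OF dv u(2) v(2)]]
    define w where "w = 1 - x * y"
    \<comment> \<open>\<open>X\<close>, \<open>X1\<close>, \<open>Y\<close>, \<open>Y1\<close>,
      \<open>Z\<close> stand for these five logarithms, in that order; the derivative is linear in
      them and each coefficient vanishes.\<close>
    have "- (X1 / x + X / (1 - x)) / 2 * 1 + 0 - - (Z / (x * y) + (X + Y) / w) / 2 * y
      - - ((X1 - Z) / (x * (1 - y) / w) + (X + Y1 - Z) / ((1 - x) / w)) / 2 * ((1 - y) / w\<^sup>2)
      - - ((Y1 - Z) / (y * (1 - x) / w) + (Y + X1 - Z) / ((1 - y) / w)) / 2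
          * (- y * (1 - y) / w\<^sup>2) = 0" for X X1 Y Y1 Z
      using nz(1-4) nz(5)[folded w_def]
      by (simp add: divide_simps power2_eq_square, simp add: w_def algebra_simps)
    from DF[unfolded 1 2 l, folded w_def, unfolded this] show ?thesis
      unfolding F_def w_def .
  qed
  \<comment> \<open>As \<open>x\<close> tends to 0, so do \<open>x * y\<close> and the first
    quotient, while the second quotient tends to \<open>y\<close>.\<close>
  moreover have "(F \<longlongrightarrow> 0 + rogers_L y - 0 - 0 - rogers_L y) (at_right 0)"
    unfolding F_def
  proof (intro tendsto_intros rogers_L_tendsto_0)
    have ev: "eventually (\<lambda>x. 0 < x \<and> x < 1) (at_right (0::real))"
      using eventually_at_right_real[of 0 1] by simp
    have "filterlim (\<lambda>x. x * y) (at_right 0) (at_right 0)"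
      unfolding filterlim_at using y
      by (auto intro!: tendsto_eq_intros eventually_mono[OF ev])
    from filterlim_compose[OF rogers_L_tendsto_0 this]
    show "((\<lambda>x. rogers_L (x * y)) \<longlongrightarrow> 0) (at_right 0)" .
    have "filterlim (\<lambda>x. x * (1 - y) / (1 - x * y)) (at_right 0) (at_right 0)"
      unfolding filterlim_at using y
      by (auto intro!: tendsto_eq_intros eventually_mono[OF ev] divide_pos_pos mult_pos_pos
          simp: lt lt[THEN less_imp_neq])
    from filterlim_compose[OF rogers_L_tendsto_0 this]
    show "((\<lambda>x. rogers_L (x * (1 - y) / (1 - x * y))) \<longlongrightarrow> 0) (at_right 0)" .
    have "isCont rogers_L y"
      using has_real_derivative_rogers_L[OF DERIV_ident] y by (blast intro: DERIV_isCont)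
    then show "((\<lambda>x. rogers_L (y * (1 - x) / (1 - x * y))) \<longlongrightarrow> rogers_L y) (at_right 0)"
      by (rule isCont_tendsto_compose) (auto intro!: tendsto_eq_intros)
  qed
  ultimately have "F x = 0"
    using eq_limit_if_zero_derivative[of 0 1 F 0 x] x by auto
  moreover have "x * (1 - y) / (1 - x * y) = u" "y * (1 - x) / (1 - x * y) = v"
    using u v lt[OF x] unfolding z[symmetric] by (simp_all add: field_simps)
  ultimately show ?thesis
    by (simp add: F_def z)
qed

text \<open>The five-term relation at \<open>y = x\<close>, where both quotients reduce to
  \<open>x / (1 + x)\<close>.\<close>

lemma rogers_L_square:
  assumes "0 < x" "x < 1"
  shows "2 * rogers_L x = rogers_L (x\<^sup>2) + 2 * rogers_L (x / (1 + x))"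
proof -
  have *: "x / (1 + x) * (1 - x\<^sup>2) = x * (1 - x)"
    using assms by (simp add: field_simps power2_eq_square)
  show ?thesis
    using rogers_L_five_term[OF assms assms power2_eq_square[symmetric] * *] by simp
qed

section \<open>The ladder at the root of the sextic\<close>

lemma dilog_ladder:
  fixes h :: real
  assumes h: "0 < h" "h < 1" and poly: "h^6 - h^5 - h^4 - 6 * h^3 - h^2 - h + 1 = 0"
  shows "Li2 (h^6) + 3 * Li2 (h^4) - 8 * Li2 (h^3) - 5 * Li2 (h^2) - 8 * Li2 h - 4 * (ln h)^2
         = - 5 * zeta2"
proof -
  \<comment> \<open>The complements to 1 factor too, mostly identically in \<open>h\<close>, such as
    \<open>1 - a = (1 - h^3) / (1 + h\<^sup>2)\<close>. For two arguments the sextic intervenes: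
    \<open>n = h\<^sup>2 / (1 - h + h\<^sup>2)\<close> and
    \<open>1 - z = (1 - h^3) / (1 + h^3)\<close>.\<close>
  define a where "a = h\<^sup>2 * (1 + h) / (1 + h\<^sup>2)"
  define b where "b = h * (1 + h\<^sup>2) / (1 + h)"
  define c where "c = h\<^sup>2 / (1 + h\<^sup>2)"
  define d where "d = h * (1 + h\<^sup>2) / (1 + h^3)"
  define e where "e = 2 * h\<^sup>2 / (1 + h\<^sup>2)"
  define f where "f = (1 - h\<^sup>2) / 2"
  define g where "g = (1 - h)\<^sup>2 / (2 * (1 - h + h\<^sup>2))"
  define k where "k = (1 - h) / 2"
  define m where "m = (1 + h\<^sup>2) / (2 * (1 + h + h\<^sup>2))"
  define n where "n = (1 - h\<^sup>2)\<^sup>2 / (8 * h)"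
  define p where "p = (1 - h^3) / 2"
  define z where "z = (1 - h)\<^sup>2 * (1 + h) / 4"
  define j where "j = h\<^sup>2 * (1 - h) / (1 + h\<^sup>2)"
  note defs = a_def b_def c_def d_def e_def f_def g_def k_def m_def n_def p_def z_def j_def
  have lt: "h\<^sup>2 < 1" "h\<^sup>2 < h" "h^3 < 1"
    using h power_strict_decreasing[of 1 2 h] by (simp_all add: power_less_one_iff)
  \<comment> \<open>Expanded, the bounds below become linear in \<open>h\<close>,
    \<open>h\<^sup>2\<close>, \<open>h^3\<close> once denominators are cleared.\<close>
  have expand: "h\<^sup>2 * (1 + h) = h\<^sup>2 + h^3" "h * (1 + h\<^sup>2) = h + h^3"
    "(1 - h)\<^sup>2 = 1 - 2 * h + h\<^sup>2"
    by algebra+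
  have sq: "0 < 1 - 2 * h + h\<^sup>2"
    unfolding expand(3)[symmetric] using h by simp
  have pos: "0 < h\<^sup>2" "0 < h^3" "0 < 1 + h" "0 < 1 + h\<^sup>2" "0 < 1 + h^3"
    "0 < 1 + h + h\<^sup>2" "0 < 1 - h + h\<^sup>2"
    using h by (simp_all add: add_pos_pos)
  have nz: "h \<noteq> 0" "1 - h \<noteq> 0" "1 + h \<noteq> 0" "1 + h\<^sup>2 \<noteq> 0" "1 + h^3 \<noteq> 0"
    "1 + h + h\<^sup>2 \<noteq> 0" "1 - h + h\<^sup>2 \<noteq> 0"
    using h pos by auto
  have "a < 1" "b < 1" "c < 1" "d < 1" "e < 1" "f < 1" "g < 1" "k < 1" "m < 1" "p < 1"
    "0 < a" "0 < b" "0 < c" "0 < d" "0 < e" "0 < f" "0 < g" "0 < k" "0 < m" "0 < p"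
    unfolding defs using h pos
    by (simp_all add: divide_simps expand, (use lt h pos sq in linarith)+)
  then have bounds: "a < 1" "b < 1" "c < 1" "d < 1" "e < 1" "f < 1" "g < 1" "k < 1" "m < 1"
    "p < 1" "1 - p < 1" "1 - d < 1"
    "0 < a" "0 < b" "0 < c" "0 < d" "0 < e" "0 < f" "0 < g" "0 < k" "0 < m" "0 < 1 - p" "0 < 1 - d"
    "0 < p" "0 < h" "h < 1" "0 < (1 / 2 :: real)" "(1 / 2 :: real) < 1"
    using h by simp_all
  \<comment> \<open>With distributed numerals the simplifier no longer recognises the denominators in \<open>nz\<close>.\<close>
  note [simp del] = distrib_left_numeral distrib_right_numeral
    left_diff_distrib_numeral right_diff_distrib_numeral
  \<comment> \<open>In each relation the left side gives \<open>x\<close> and \<open>y\<close>.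
    Clearing denominators leaves polynomial equations; \<open>r7\<close> to \<open>r11\<close>
    contain some that hold modulo the sextic, hence the alternative with
    \<open>poly\<close>.\<close>
  have r4: "rogers_L a + rogers_L b = rogers_L (h^3) + rogers_L c + rogers_L (h / (1 + h))"
    by (rule rogers_L_five_term; (rule bounds)?; (simp add: defs nz divide_simps)?;
        (algebra | (insert poly, algebra))?)
  have r5: "rogers_L c + rogers_L d = rogers_L (h^3 / (1 + h^3)) + rogers_L j + rogers_L h"
    by (rule rogers_L_five_term; (rule bounds)?; (simp add: defs nz divide_simps)?;
        (algebra | (insert poly, algebra))?)
  have r6: "rogers_L e + rogers_L (1 / 2) = rogers_L c + rogers_L (h^2) + rogers_L f"
    by (rule rogers_L_five_term; (rule bounds)?; (simp add: defs nz divide_simps)?;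
        (algebra | (insert poly, algebra))?)
  have r7: "rogers_L g + rogers_L (1 - p) = rogers_L z + rogers_L z + rogers_L p"
    by (rule rogers_L_five_term; (rule bounds)?; (simp add: defs nz divide_simps)?;
        (algebra | (insert poly, algebra))?)
  have r8: "rogers_L e + rogers_L k = rogers_L j + rogers_L n + rogers_L g"
    by (rule rogers_L_five_term; (rule bounds)?; (simp add: defs nz divide_simps)?;
        (algebra | (insert poly, algebra))?)
  have r9: "rogers_L m + rogers_L (1 - p) = rogers_L a + rogers_L n + rogers_L f"
    by (rule rogers_L_five_term; (rule bounds)?; (simp add: defs nz divide_simps)?;
        (algebra | (insert poly, algebra))?)
  have r10: "rogers_L k + rogers_L f = rogers_L z + rogers_L a + rogers_L b"
    by (rule rogers_L_five_term; (rule bounds)?; (simp add: defs nz divide_simps)?;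
        (algebra | (insert poly, algebra))?)
  have r11: "rogers_L (1 - p) + rogers_L (1 - d) = rogers_L k + rogers_L b + rogers_L m"
    by (rule rogers_L_five_term; (rule bounds)?; (simp add: defs nz divide_simps)?;
        (algebra | (insert poly, algebra))?)
  have r1: "2 * rogers_L (h^2) = rogers_L (h^4) + 2 * rogers_L c"
    using rogers_L_square[of "h^2"] lt pos by (simp add: c_def)
  have r2: "2 * rogers_L (h^3) = rogers_L (h^6) + 2 * rogers_L (h^3 / (1 + h^3))"
    using rogers_L_square[of "h^3"] lt pos by simp
  have r3: "2 * rogers_L h = rogers_L (h^2) + 2 * rogers_L (h / (1 + h))"
    using rogers_L_square[OF h] .
  have "rogers_L p + rogers_L (1 - p) = zeta2" "rogers_L d + rogers_L (1 - d) = zeta2"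
    using bounds by (simp_all add: rogers_L_reflection)
  \<comment> \<open>The multipliers of \<open>r1\<close> to \<open>r11\<close> are -3, -1, -3, 6, 2, 2, -2, -2, 2, 4, 2.\<close>
  with r1 r2 r3 r4 r5 r6 r7 r8 r9 r10 r11
  have L: "rogers_L (h^6) + 3 * rogers_L (h^4) - 8 * rogers_L (h^3) - 5 * rogers_L (h^2) - 8 * rogers_L h
      = - 5 * zeta2"
    using rogers_L_half by linarith
  \<comment> \<open>Cyclotomic factors, to express all logarithms through a few common ones.\<close>
  have "1 - h^2 = (1 - h) * (1 + h)" "1 - h^3 = (1 - h) * (1 + h + h^2)"
    "1 - h^4 = (1 - h) * (1 + h) * (1 + h^2)"
    "1 - h^6 = (1 - h) * (1 + h) * (1 + h + h^2) * (1 - h + h^2)"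
    by algebra+
  then have ln1: "ln (1 - h^2) = ln (1 - h) + ln (1 + h)" "ln (1 - h^3) = ln (1 - h) + ln (1 + h + h^2)"
    "ln (1 - h^4) = ln (1 - h) + ln (1 + h) + ln (1 + h^2)"
    "ln (1 - h^6) = ln (1 - h) + ln (1 + h) + ln (1 + h + h^2) + ln (1 - h + h^2)"
    using h pos by (simp_all add: ln_mult)
  have "(1 + h^2) ^ 3 = h * (1 + h) ^ 4"
    "(1 - h + h^2) * h^2 * (1 + h)^4 = (1 - h)^4 * (1 + h + h^2)^3"
    by (algebra | (insert poly, algebra))+
  then have "ln ((1 + h^2) ^ 3) = ln (h * (1 + h) ^ 4)"
    "ln ((1 - h + h^2) * h^2 * (1 + h)^4) = ln ((1 - h)^4 * (1 + h + h^2)^3)"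
    by simp_all
  then have E: "3 * ln (1 + h^2) = ln h + 4 * ln (1 + h)"
    and G: "ln (1 - h + h^2) + 2 * ln h + 4 * ln (1 + h) = 4 * ln (1 - h) + 3 * ln (1 + h + h^2)"
    using h pos by (simp_all add: ln_mult ln_realpow)
  \<comment> \<open>The coefficients are those of the ladder times the exponents, as
    \<open>ln (h^k) = k * ln h\<close>. The sum reduces by 4 times \<open>E\<close> and 6 times
    \<open>G\<close>.\<close>
  have "6 * ln (1 - h^6) + 12 * ln (1 - h^4) - 24 * ln (1 - h^3) - 10 * ln (1 - h^2)
      - 8 * ln (1 - h) = - 8 * ln h"
    unfolding ln1 using E G by argo
  then have "ln h * (6 * ln (1 - h^6) + 12 * ln (1 - h^4) - 24 * ln (1 - h^3) - 10 * ln (1 - h^2)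
      - 8 * ln (1 - h)) = - 8 * (ln h)^2"
    by (simp add: power2_eq_square)
  then show ?thesis
    using L h unfolding rogers_L_def by (simp add: ln_realpow algebra_simps)
qed

theorem theorem6:
  shows "(\<exists>!h::real. 0 < h \<and> h < 1 \<and> h^6 - h^5 - h^4 - 6 * h^3 - h^2 - h + 1 = 0) \<and>
    (\<forall>h::real. 0 < h \<and> h < 1 \<and> h^6 - h^5 - h^4 - 6 * h^3 - h^2 - h + 1 = 0 \<longrightarrow>
       Li2 (h^6) + 3 * Li2 (h^4) - 8 * Li2 (h^3) - 5 * Li2 (h^2) - 8 * Li2 h - 4 * (ln h)^2
         = - 5 * zeta2)"

proof (intro conjI allI impI)
  show "\<exists>!h::real. 0 < h \<and> h < 1 \<and> h^6 - h^5 - h^4 - 6 * h^3 - h^2 - h + 1 = 0"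
  proof (rule ex_ex1I)
    \<comment> \<open>The sextic is 1 at 0 and -8 at 1, so neither endpoint is a root.\<close>
    have "\<exists>h\<ge>0. h \<le> 1 \<and> h^6 - h^5 - h^4 - 6 * h^3 - h^2 - h + 1 = (0::real)"
      by (rule IVT2) (auto intro!: continuous_intros)
    then obtain h :: real where "0 \<le> h" "h \<le> 1" "h^6 - h^5 - h^4 - 6 * h^3 - h^2 - h + 1 = 0"
      by blast
    moreover from this have "h \<noteq> 0" "h \<noteq> 1" by auto
    ultimately show "\<exists>h::real. 0 < h \<and> h < 1 \<and> h^6 - h^5 - h^4 - 6 * h^3 - h^2 - h + 1 = 0"
      by (intro exI[of _ h]) auto
  next
    \<comment> \<open>The sextic decreases strictly: its only increasing term \<open>x^6\<close> is
      dominated by \<open>- 6 * x^3\<close>, and the linear term gives strictness.\<close>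
    have less: "y^6 - y^5 - y^4 - 6 * y^3 - y^2 - y + 1 < x^6 - x^5 - x^4 - 6 * x^3 - x^2 - x + 1"
      if "0 < x" "x < y" "y < 1" for x y :: real
    proof -
      have le: "x^n \<le> y^n" for n
        using that by (intro power_mono) auto
      have "y^3 \<le> 1" "x^3 \<le> 1"
        using that by (intro power_le_one; simp)+
      then have "(y^3 - x^3) * (x^3 + y^3 - 6) \<le> 0"
        using le[of 3] by (intro mult_nonneg_nonpos) auto
      moreover have "(y^3 - x^3) * (x^3 + y^3 - 6) = (y^6 - 6 * y^3) - (x^6 - 6 * x^3)"
        by algebra
      ultimately show ?thesis
        using le[of 5] le[of 4] le[of 2] that by linarith
    qed
    show "x = y" if "0 < x \<and> x < 1 \<and> x^6 - x^5 - x^4 - 6 * x^3 - x^2 - x + 1 = 0"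
      "0 < y \<and> y < 1 \<and> y^6 - y^5 - y^4 - 6 * y^3 - y^2 - y + 1 = 0" for x y :: real
      using that less[of x y] less[of y x] by linarith
  qed
qed (use dilog_ladder in blast)

end
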